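(* Let $k\ge 1$ be an integer, let $\mathcal{S}$ be a measurable space, let $\xi_1,\xi_2,\dots$ be i.i.d. $\mathcal{S}$-valued random elements, and let $h:\mathcal{S}^k\to\mathbb{R}$ be a symmetric Borel (measurable) function. For $n\ge k$ put $$H_n=\max_{1\le i_1<\dots<i_k\le n} h(\xi_{i_1},\dots,\xi_{i_k}).$$ For $z\in\mathbb{R}$ put $$p_{n,z}=\mathbf{P}\{h(\xi_1,\dots,\xi_k)>z\},\qquad \lambda_{n,z}=\binom{n}{k}p_{n,z},$$ and, for $r\in\{1,\dots,k-1\}$, $$\tau_{n,z}(r)=p_{n,z}^{-1}\,\mathbf{P}\{h(\xi_1,\dots,\xi_k)>z,\ h(\xi_{1+k-r},\xi_{2+k-r},\dots,\xi_{2k-r})>z\}$$ (with $\tau_{n,z}(r)=0$ if $p_{n,z}=0$). Then for any $n\ge k$ and any $z\in\mathbb{R}$, $$\left|\mathbf{P}\{H_n\le z\}-\exp\{-\lambda_{n,z}\}\right|\le (1-\exp\{-\lambda_{n,z}\})\left\{p_{n,z}\left[\binom{n}{k}-\binom{n-k}{k}\right]+\sum_{r=1}^{k-1}\binom{k}{r}\binom{n-k}{k-r}\tau_{n,z}(r)\right\}.$$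
   Context: Symmetric means invariant under all permutations of the $k$ arguments. The sum over $r$ is zero when $k=1$, and $\binom{m}{j}=0$ for integers $0\le m<j$. *)

theory Defs
  imports "HOL-Probability.Probability"
begin

text \<open>
  Points of \<open>S\<^sup>k\<close> are the elements of \<open>space (PiM {1..k} (\<lambda>_. S))\<close>, that is, functions on
  \<open>{1..k}\<close> that are undefined elsewhere; \<open>S\<^sup>k\<close> carries the product sigma-algebra.
\<close>

definition symmetric_kernel :: "nat \<Rightarrow> 'b measure \<Rightarrow> ((nat \<Rightarrow> 'b) \<Rightarrow> real) \<Rightarrow> bool" where
  "symmetric_kernel k S h \<longleftrightarrow>
     (\<forall>\<pi> x. \<pi> permutes {1..k} \<longrightarrow> x \<in> space (PiM {1..k} (\<lambda>_. S)) \<longrightarrow>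
        h (\<lambda>j\<in>{1..k}. x (\<pi> j)) = h x)"

text \<open>
  Sequences are indexed from 1; the value of a sequence at index 0 is irrelevant. The measurability
  of each \<open>\<xi> i\<close> is part of \<open>prob_space.indep_vars\<close>.
\<close>

definition iid_sequence :: "'a measure \<Rightarrow> 'b measure \<Rightarrow> (nat \<Rightarrow> 'a \<Rightarrow> 'b) \<Rightarrow> bool" where
  "iid_sequence M S \<xi> \<longleftrightarrow>
     prob_space.indep_vars M (\<lambda>_. S) \<xi> {1..} \<and>
     (\<forall>i\<ge>1. distr M S (\<xi> i) = distr M S (\<xi> 1))"

definition subsample :: "nat \<Rightarrow> (nat \<Rightarrow> 'a \<Rightarrow> 'b) \<Rightarrow> (nat \<Rightarrow> nat) \<Rightarrow> 'a \<Rightarrow> (nat \<Rightarrow> 'b)" where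
  "subsample k \<xi> i \<omega> = (\<lambda>j\<in>{1..k}. \<xi> (i j) \<omega>)"

definition index_tuples :: "nat \<Rightarrow> nat \<Rightarrow> (nat \<Rightarrow> nat) set" where
  "index_tuples k n = {i \<in> {1..k} \<rightarrow>\<^sub>E {1..n}. strict_mono_on {1..k} i}"

text \<open>For \<open>n < k\<close> the maximum is over the empty set and carries no meaning.\<close>

definition U_max ::
  "nat \<Rightarrow> ((nat \<Rightarrow> 'b) \<Rightarrow> real) \<Rightarrow> (nat \<Rightarrow> 'a \<Rightarrow> 'b) \<Rightarrow> nat \<Rightarrow> 'a \<Rightarrow> real" where
  "U_max k h \<xi> n \<omega> = Max ((\<lambda>i. h (subsample k \<xi> i \<omega>)) ` index_tuples k n)"

text \<open>\<open>p\<^sub>n\<^sub>,\<^sub>z\<close> and \<open>\<tau>\<^sub>n\<^sub>,\<^sub>z(r)\<close> do not depend on \<open>n\<close>.\<close>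

definition exceed_prob ::
  "'a measure \<Rightarrow> nat \<Rightarrow> ((nat \<Rightarrow> 'b) \<Rightarrow> real) \<Rightarrow> (nat \<Rightarrow> 'a \<Rightarrow> 'b) \<Rightarrow> real \<Rightarrow> real" where
  "exceed_prob M k h \<xi> z = \<P>(\<omega> in M. h (subsample k \<xi> (\<lambda>j. j) \<omega>) > z)"

definition exceed_rate ::
  "'a measure \<Rightarrow> nat \<Rightarrow> ((nat \<Rightarrow> 'b) \<Rightarrow> real) \<Rightarrow> (nat \<Rightarrow> 'a \<Rightarrow> 'b) \<Rightarrow> nat \<Rightarrow> real \<Rightarrow> real" where
  "exceed_rate M k h \<xi> n z = real (n choose k) * exceed_prob M k h \<xi> z"

text \<open>
  Used for \<open>1 \<le> r < k\<close> only, so \<open>k - r\<close> is not truncated; the two subsamples share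
  \<open>r\<close> indices.
\<close>

definition exceed_tau ::
  "'a measure \<Rightarrow> nat \<Rightarrow> ((nat \<Rightarrow> 'b) \<Rightarrow> real) \<Rightarrow> (nat \<Rightarrow> 'a \<Rightarrow> 'b) \<Rightarrow> real \<Rightarrow> nat \<Rightarrow> real" where
  "exceed_tau M k h \<xi> z r =
     (if exceed_prob M k h \<xi> z = 0 then 0
      else \<P>(\<omega> in M. h (subsample k \<xi> (\<lambda>j. j) \<omega>) > z \<and>
                         h (subsample k \<xi> (\<lambda>j. j + (k - r)) \<omega>) > z)
           / exceed_prob M k h \<xi> z)"

end

theory Submission
  imports Defs
begin

text \<open>
  The event \<open>H\<^sub>n \<le> z\<close> says that no \<open>k\<close>-subset \<open>J\<close> of \<open>{1..n}\<close> has its kernel value above \<open>z\<close>.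
  The number \<open>W\<close> of such subsets is a sum of indicators, the one of \<open>J\<close> being independent of those of
  all subsets disjoint from \<open>J\<close>, so the Chen-Stein method for locally dependent indicators applies.
  For the target set \<open>{0}\<close> the Stein equation \<open>l f(w + 1) - w f(w) = 1\<^bsub>w = 0\<^esub> - exp (- l)\<close>
  is solved by \<open>f(w + 1) = \<integral>\<^sub>0\<^sup>1 s\<^sup>w exp (- l s) ds\<close>, which takes values between \<open>0\<close> and
  \<open>f(1) = (1 - exp (- l)) / l\<close>; this gives the factor \<open>1 - exp (- l)\<close>. Two subsets with \<open>r\<close>
  common elements exceed jointly with probability \<open>p \<tau>(r)\<close> by exchangeability and symmetry of \<open>h\<close>.
\<close>

section \<open>Stein's equation and the Chen-Stein bound for locally dependent events\<close>

text \<open>The index is shifted: \<open>g w\<close> is the usual solution \<open>f\<close> of the Stein equation at \<open>w + 1\<close>.\<close>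

lemma stein_solution:
  fixes l :: real
  assumes l: "l > 0"
  obtains g :: "nat \<Rightarrow> real"
  where "l * g 0 = 1 - exp (- l)"
    and "\<And>w. l * g (Suc w) = Suc w * g w - exp (- l)"
    and "\<And>w. 0 \<le> g w" and "\<And>w. g w \<le> g 0"
proof
  define g where "g w = integral {0..1} (\<lambda>s. s ^ w * exp (- l * s))" for w :: nat
  have int: "(\<lambda>s. s ^ w * exp (- l * s)) integrable_on {0..1}" for w
    by (intro integrable_continuous_interval continuous_intros)
  have "((\<lambda>s. l * (s ^ 0 * exp (- l * s))) has_integral (- exp (- l * 1) - - exp (- l * 0))) {0..1}"
    by (rule fundamental_theorem_of_calculus)
       (auto intro!: derivative_eq_intros simp flip: has_real_derivative_iff_has_vector_derivative)
  then show "l * g 0 = 1 - exp (- l)"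
    unfolding g_def by (simp flip: integral_mult_right add: integral_unique)
  show "l * g (Suc w) = Suc w * g w - exp (- l)" for w
  proof -
    \<comment> \<open>Integration by parts: integrating this derivative over the unit interval
      leaves only the boundary value \<open>exp (- l)\<close>, because \<open>s ^ Suc w\<close>
      vanishes at 0.\<close>
    have "((\<lambda>s. s ^ Suc w * exp (- l * s)) has_real_derivative
        Suc w * (x ^ w * exp (- l * x)) - l * (x ^ Suc w * exp (- l * x))) (at x within {0..1})" for x
      by (rule derivative_eq_intros refl)+ (cases w; simp add: algebra_simps)
    then have "((\<lambda>s. Suc w * (s ^ w * exp (- l * s)) - l * (s ^ Suc w * exp (- l * s))) has_integral
       (1 ^ Suc w * exp (- l * 1) - 0 ^ Suc w * exp (- l * 0))) {0..1}"
      by (intro fundamental_theorem_of_calculus) (auto simp flip: has_real_derivative_iff_has_vector_derivative)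
    from integral_unique[OF this]
    have "Suc w * g w - l * g (Suc w) = exp (- l)"
      unfolding g_def by (subst (asm) integral_diff)
        (use int[of w] int[of "Suc w"] in \<open>auto intro!: integrable_on_mult_right\<close>)
    then show ?thesis by simp
  qed
  show "0 \<le> g w" for w
    unfolding g_def by (rule integral_nonneg[OF int]) auto
  show "g w \<le> g 0" for w
    unfolding g_def by (rule integral_le[OF int int]) (auto simp: power_le_one mult_left_le_one_le)
qed

text \<open>Taking expectations in the Stein equation at the number of occurring events splits the
  error into one term per \<open>i\<close>. In each term the events in the neighbourhood
  \<open>B i\<close> are dropped from the count; what remains is independent of \<open>E i\<close>
  and cancels, and each dropped event costs at most \<open>g 0\<close>. Independence is assumed in
  exactly the form in which it enters.\<close>

lemma (in prob_space) chen_stein_void_probability: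
  fixes E :: "'i \<Rightarrow> 'a set" and B :: "'i \<Rightarrow> 'i set"
  assumes A: "finite A" and E: "\<And>i. i \<in> A \<Longrightarrow> E i \<in> events"
    and B: "\<And>i. i \<in> A \<Longrightarrow> i \<in> B i" "\<And>i. i \<in> A \<Longrightarrow> B i \<subseteq> A"
    and indep: "\<And>i. i \<in> A \<Longrightarrow> indep_var borel (indicat_real (E i))
                  borel (\<lambda>\<omega>. real (card {j \<in> A - B i. \<omega> \<in> E j}))"
    and l_def: "l = (\<Sum>i\<in>A. prob (E i))"
  shows "\<bar>prob (space M - \<Union> (E ` A)) - exp (- l)\<bar> \<le> (1 - exp (- l)) / l *
    (\<Sum>i\<in>A. (\<Sum>j\<in>B i. prob (E i) * prob (E j)) + (\<Sum>j\<in>B i - {i}. prob (E i \<inter> E j)))"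
\<comment> \<open>For \<open>l = 0\<close> the quotient by \<open>l\<close> is 0 by convention, so
  the left side must vanish exactly; it does, since all events are then null.\<close>
proof (cases "l = 0")
  case True
  then have "prob (E i) = 0" if "i \<in> A" for i
    using A that sum_nonneg_eq_0_iff[of A "\<lambda>i. prob (E i)"] by (auto simp: l_def)
  then have "prob (\<Union> (E ` A)) \<le> 0"
    using finite_measure_subadditive_finite[OF A, of E] E by auto
  then have "prob (space M - \<Union> (E ` A)) = 1"
    using A E by (subst prob_compl) (auto simp: measure_le_0_iff)
  with True show ?thesis by simp
next
  case False
  then have l: "l > 0" by (simp add: l_def order_less_le sum_nonneg)
  obtain g :: "nat \<Rightarrow> real" where g0: "l * g 0 = 1 - exp (- l)"
    and gS: "\<And>w. l * g (Suc w) = Suc w * g w - exp (- l)"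
    and g_nonneg: "\<And>w. 0 \<le> g w" and g_le: "\<And>w. g w \<le> g 0"
    using stein_solution[OF l] by metis
  \<comment> \<open>Both values lie between 0 and \<open>g 0\<close>, so they differ by at most
    \<open>g 0\<close>, which is at most \<open>g 0 * b\<close> as soon as \<open>b\<close> is at
    least 1.\<close>
  have g_lip: "\<bar>g (a + b) - g a\<bar> \<le> g 0 * real b" for a b
  proof (cases "b = 0")
    case False
    have "\<bar>g (a + b) - g a\<bar> \<le> g 0"
      using g_nonneg[of a] g_nonneg[of "a + b"] g_le[of a] g_le[of "a + b"] by linarith
    also have "\<dots> \<le> g 0 * real b" using g_nonneg[of 0] False by (simp add: mult_le_cancel_left1)
    finally show ?thesis .
  qed simp
  define N where "N C \<omega> = card {j \<in> C. \<omega> \<in> E j}" for C \<omega>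
  define I where "I i = indicat_real (E i)" for i
  have I[measurable]: "I i \<in> borel_measurable M" if "i \<in> A" for i
    using E[OF that] by (simp add: I_def)
  have N_sum: "real (N C \<omega>) = (\<Sum>j\<in>C. I j \<omega>)" if "C \<subseteq> A" for C \<omega>
    using finite_subset[OF that A]
    by (simp add: N_def I_def indicator_def sum.If_cases Int_def)
  \<comment> \<open>Rounding the real sum of indicators recovers the count as a map into a discrete
    space, so that it can be composed with the arbitrary function \<open>g\<close>.\<close>
  have N[measurable]: "N C \<in> measurable M (count_space UNIV)" if "C \<subseteq> A" for C
  proof -
    have "(\<lambda>\<omega>. \<Sum>j\<in>C. I j \<omega>) \<in> borel_measurable M"
      using that I by (intro borel_measurable_sum) auto
    moreover have "(\<lambda>x::real. nat \<lfloor>x\<rfloor>) \<in> measurable borel (count_space UNIV)" by measurable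
    ultimately have "(\<lambda>\<omega>. nat \<lfloor>\<Sum>j\<in>C. I j \<omega>\<rfloor>) \<in> measurable M (count_space UNIV)"
      by (rule measurable_compose)
    then show ?thesis by (simp flip: N_sum[OF that])
  qed
  have int: "integrable M (\<lambda>\<omega>. g (N C \<omega>))" if "C \<subseteq> A" for C
    using that by (intro integrable_const_bound[where B="g 0"]) (auto simp: g_nonneg g_le)
  have intI: "integrable M (\<lambda>\<omega>. I i \<omega> * g (N C \<omega>))" if "C \<subseteq> A" "i \<in> A" for C i
  proof (rule integrable_const_bound[where B="g 0"])
    show "AE \<omega> in M. norm (I i \<omega> * g (N C \<omega>)) \<le> g 0"
      by (simp add: I_def indicator_def g_nonneg g_le)
  qed (use that in measurable)
  have exI: "integrable M (I i)" "expectation (I i) = prob (E i)" if "i \<in> A" for i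
    using E[OF that] by (auto simp: I_def emeasure_eq_measure)
  have intN: "integrable M (\<lambda>\<omega>. real (N C \<omega>))" if "C \<subseteq> A" for C
    using that exI(1) by (auto simp: N_sum)
  have exN: "expectation (\<lambda>\<omega>. real (N C \<omega>)) = (\<Sum>j\<in>C. prob (E j))" if "C \<subseteq> A" for C
    unfolding N_sum[OF that] using that exI
    by (subst Bochner_Integration.integral_sum) (auto intro!: sum.cong)
  have intIN: "integrable M (\<lambda>\<omega>. I i \<omega> * real (N C \<omega>))" if "C \<subseteq> A" "i \<in> A" for C i
  proof (rule integrable_const_bound[where B="card A"])
    show "AE \<omega> in M. norm (I i \<omega> * real (N C \<omega>)) \<le> card A"
      using that A by (auto simp: I_def indicator_def N_def intro!: card_mono)
  qed (use that in measurable)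
  have N_Un: "N A \<omega> = N (A - C) \<omega> + N C \<omega>" if "C \<subseteq> A" for C \<omega>
    unfolding N_def using A that finite_subset[OF that A]
    by (subst card_Un_disjoint[symmetric]) (auto intro: arg_cong[where f=card])
  \<comment> \<open>On \<open>E i\<close>, removing \<open>i\<close> lowers the count by one, so the
    sum equals \<open>N A \<omega> * g (N A \<omega> - 1)\<close>. If the count is 0 this product
    vanishes, whatever the truncated subtraction yields, and the equation for \<open>g 0\<close>
    applies.\<close>
  have stein: "l * g (N A \<omega>) - (\<Sum>i\<in>A. I i \<omega> * g (N (A - {i}) \<omega>)) =
      indicator (space M - \<Union> (E ` A)) \<omega> - exp (- l)" if "\<omega> \<in> space M" for \<omega>
  proof -
    have *: "I i \<omega> * g (N (A - {i}) \<omega>) = I i \<omega> * g (N A \<omega> - 1)" if "i \<in> A" for i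
    proof (cases "\<omega> \<in> E i")
      case True
      then have "{j \<in> {i}. \<omega> \<in> E j} = {i}" by auto
      then have "N {i} \<omega> = 1" by (simp add: N_def)
      then show ?thesis using N_Un[of "{i}" \<omega>] that by simp
    qed (simp add: I_def)
    have "(\<Sum>i\<in>A. I i \<omega> * g (N (A - {i}) \<omega>)) = real (N A \<omega>) * g (N A \<omega> - 1)"
      by (simp add: * N_sum sum_distrib_right)
    moreover have "N A \<omega> = 0 \<longleftrightarrow> \<omega> \<notin> \<Union> (E ` A)"
      using A by (auto simp: N_def)
    ultimately show ?thesis using that gS[of "N A \<omega> - 1"] g0
      by (cases "N A \<omega>") (auto simp: indicator_def)
  qed
  have V: "space M - \<Union> (E ` A) \<in> events" using A E by auto
  define d where "d i = prob (E i) * expectation (\<lambda>\<omega>. g (N A \<omega>)) - expectation (\<lambda>\<omega>. I i \<omega> * g (N (A - {i}) \<omega>))" for i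
  have "prob (space M - \<Union> (E ` A)) - exp (- l) =
      expectation (\<lambda>\<omega>. indicator (space M - \<Union> (E ` A)) \<omega> - exp (- l))"
    using V by (simp add: emeasure_eq_measure prob_space)
  also have "\<dots> = expectation (\<lambda>\<omega>. l * g (N A \<omega>) - (\<Sum>i\<in>A. I i \<omega> * g (N (A - {i}) \<omega>)))"
    by (intro Bochner_Integration.integral_cong refl) (simp add: stein)
  also have "\<dots> = l * expectation (\<lambda>\<omega>. g (N A \<omega>)) - (\<Sum>i\<in>A. expectation (\<lambda>\<omega>. I i \<omega> * g (N (A - {i}) \<omega>)))"
    by (simp add: Bochner_Integration.integral_diff Bochner_Integration.integral_sum int intI)
  also have "\<dots> = (\<Sum>i\<in>A. d i)"
    by (simp add: d_def l_def sum_distrib_right sum_subtractf)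
  finally have main: "prob (space M - \<Union> (E ` A)) - exp (- l) = (\<Sum>i\<in>A. d i)" .
  have "\<bar>d i\<bar> \<le> g 0 * ((\<Sum>j\<in>B i. prob (E i) * prob (E j)) + (\<Sum>j\<in>B i - {i}. prob (E i \<inter> E j)))"
    if i: "i \<in> A" for i
  proof -
    let ?Y = "\<lambda>\<omega>. N (A - B i) \<omega>"
    have ind: "expectation (\<lambda>\<omega>. I i \<omega> * g (?Y \<omega>)) = prob (E i) * expectation (\<lambda>\<omega>. g (?Y \<omega>))"
    proof -
      \<comment> \<open>The hypothesis concerns the count as a real variable; the Borel map
        \<open>g (nat \<lfloor>x\<rfloor>)\<close> turns it into the required function of the
        count.\<close>
      have "indep_var borel ((\<lambda>x. x) \<circ> I i) borel ((\<lambda>x. g (nat \<lfloor>x\<rfloor>)) \<circ> (\<lambda>\<omega>. real (?Y \<omega>)))"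
        using indep[OF i] unfolding I_def N_def by (rule indep_var_compose) auto
      from indep_var_lebesgue_integral[OF this] show ?thesis
        using exI[OF i] int[of "A - B i"] by (auto simp: comp_def)
    qed
    have N1: "N A \<omega> = ?Y \<omega> + N (B i) \<omega>" for \<omega>
      using N_Un B i by blast
    have N2: "N (A - {i}) \<omega> = ?Y \<omega> + N (B i - {i}) \<omega>" for \<omega>
      using A B(1)[OF i] B(2)[OF i] finite_subset[OF B(2)[OF i] A] unfolding N_def
      by (subst card_Un_disjoint[symmetric]) (auto intro: arg_cong[where f=card])
    \<comment> \<open>The terms with \<open>g (?Y \<omega>)\<close> inserted on both sides cancel by
      \<open>ind\<close>. The two remaining differences compare the full and the reduced count with
      the count outside \<open>B i\<close>.\<close>
    have "d i = prob (E i) * expectation (\<lambda>\<omega>. g (N A \<omega>) - g (?Y \<omega>))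
        - expectation (\<lambda>\<omega>. I i \<omega> * g (N (A - {i}) \<omega>) - I i \<omega> * g (?Y \<omega>))"
      using i by (simp add: d_def Bochner_Integration.integral_diff int intI ind right_diff_distrib)
    also have "\<bar>\<dots>\<bar> \<le> prob (E i) * expectation (\<lambda>\<omega>. \<bar>g (N A \<omega>) - g (?Y \<omega>)\<bar>)
        + expectation (\<lambda>\<omega>. \<bar>I i \<omega> * g (N (A - {i}) \<omega>) - I i \<omega> * g (?Y \<omega>)\<bar>)"
      by (rule order.trans[OF abs_triangle_ineq4])
         (auto simp: abs_mult intro!: add_mono mult_left_mono integral_abs_bound)
    finally have d: "\<bar>d i\<bar> \<le> prob (E i) * expectation (\<lambda>\<omega>. \<bar>g (N A \<omega>) - g (?Y \<omega>)\<bar>)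
        + expectation (\<lambda>\<omega>. \<bar>I i \<omega> * g (N (A - {i}) \<omega>) - I i \<omega> * g (?Y \<omega>)\<bar>)" .
    have "expectation (\<lambda>\<omega>. \<bar>g (N A \<omega>) - g (?Y \<omega>)\<bar>) \<le> expectation (\<lambda>\<omega>. g 0 * real (N (B i) \<omega>))"
      using B(2)[OF i] by (intro integral_mono integrable_abs Bochner_Integration.integrable_diff
          int integrable_mult_right intN) (auto simp: N1 g_lip)
    also have "\<dots> = g 0 * (\<Sum>j\<in>B i. prob (E j))"
      using B(2)[OF i] by (simp add: exN)
    finally have far: "prob (E i) * expectation (\<lambda>\<omega>. \<bar>g (N A \<omega>) - g (?Y \<omega>)\<bar>)
        \<le> prob (E i) * (g 0 * (\<Sum>j\<in>B i. prob (E j)))"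
      by (simp add: mult_left_mono)
    \<comment> \<open>The count already omits \<open>i\<close> here, so only
      \<open>B i - {i}\<close> is dropped. This is why the joint probabilities run over
      \<open>B i - {i}\<close> and the products over all of \<open>B i\<close>.\<close>
    have "expectation (\<lambda>\<omega>. \<bar>I i \<omega> * g (N (A - {i}) \<omega>) - I i \<omega> * g (?Y \<omega>)\<bar>)
        \<le> expectation (\<lambda>\<omega>. g 0 * (I i \<omega> * real (N (B i - {i}) \<omega>)))"
      using B(2)[OF i] i by (intro integral_mono integrable_abs Bochner_Integration.integrable_diff
          intI integrable_mult_right intIN) (auto simp: N2 g_lip I_def indicator_def)
    also have "\<dots> = g 0 * (\<Sum>j\<in>B i - {i}. prob (E i \<inter> E j))"
    proof -
      have "I i \<omega> * real (N (B i - {i}) \<omega>) = (\<Sum>j\<in>B i - {i}. indicator (E i \<inter> E j) \<omega>)" for \<omega>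
        using B(2)[OF i] by (subst N_sum) (auto simp: I_def indicator_inter_arith sum_distrib_left)
      moreover have "E i \<inter> E j \<in> events" if "j \<in> B i" for j using E i B(2)[OF i] that by auto
      ultimately show ?thesis
        by (simp add: Bochner_Integration.integral_sum emeasure_eq_measure)
    qed
    finally show ?thesis using d far
      by (simp add: distrib_left sum_distrib_left mult_ac)
  qed
  then have "\<bar>\<Sum>i\<in>A. d i\<bar> \<le> (\<Sum>i\<in>A. g 0 * ((\<Sum>j\<in>B i. prob (E i) * prob (E j)) + (\<Sum>j\<in>B i - {i}. prob (E i \<inter> E j))))"
    by (intro order.trans[OF sum_abs] sum_mono)
  moreover have "g 0 = (1 - exp (- l)) / l" using g0 l by (simp add: field_simps)
  ultimately show ?thesis by (simp add: main sum_distrib_left)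
qed

section \<open>Independence and exchangeability of i.i.d. sequences\<close>

lemma (in prob_space) indep_var_cong_space:
  assumes "indep_var S X T Y"
    and X: "\<And>\<omega>. \<omega> \<in> space M \<Longrightarrow> X \<omega> = X' \<omega>" and Y: "\<And>\<omega>. \<omega> \<in> space M \<Longrightarrow> Y \<omega> = Y' \<omega>"
  shows "indep_var S X' T Y'"
proof -
  have "X -` A \<inter> space M = X' -` A \<inter> space M" "Y -` B \<inter> space M = Y' -` B \<inter> space M" for A B
    using X Y by auto
  moreover have "random_variable S X \<longleftrightarrow> random_variable S X'" "random_variable T Y \<longleftrightarrow> random_variable T Y'"
    using X Y by (auto intro!: measurable_cong)
  ultimately show ?thesis using assms(1) unfolding indep_var_eq by (simp only:)
qed

lemma (in prob_space) iid_sequence_random_variable: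
  "iid_sequence M S \<xi> \<Longrightarrow> i \<ge> 1 \<Longrightarrow> random_variable S (\<xi> i)"
  unfolding iid_sequence_def indep_vars_def by simp

text \<open>By independence the selected variables have a product law with all factors equal to the
  law of \<open>\<xi> 1\<close>; relabelling coordinates along the injection \<open>e\<close>
  preserves this form.\<close>

lemma (in prob_space) iid_sequence_distr_reindex:
  assumes iid: "iid_sequence M S \<xi>" and e: "inj_on e T" "e ` T \<subseteq> {1..}" and T: "T \<noteq> {}"
  shows "distr M (PiM T (\<lambda>_. S)) (\<lambda>\<omega>. \<lambda>j\<in>T. \<xi> (e j) \<omega>) = PiM T (\<lambda>_. distr M S (\<xi> 1))"
proof -
  let ?D = "distr M S (\<xi> 1)"
  have ind: "indep_vars (\<lambda>_. S) \<xi> (e ` T)"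
    using iid e(2) unfolding iid_sequence_def by (blast intro: indep_vars_subset)
  have eq: "distr M S (\<xi> i) = ?D" if "i \<in> e ` T" for i
    using iid e(2) that unfolding iid_sequence_def by (metis atLeast_iff subsetD)
  have rv: "random_variable S (\<xi> i)" if "i \<in> e ` T" for i
    using iid_sequence_random_variable[OF iid] e(2) that by auto
  have D: "prob_space ?D" by (rule prob_space_distr) (simp add: iid_sequence_random_variable[OF iid])
  have sets: "sets (PiM T (\<lambda>_. S)) = sets (PiM T (\<lambda>_. ?D))"
    by (rule sets_PiM_cong) auto
  have "distr M (PiM (e ` T) (\<lambda>_. S)) (\<lambda>\<omega>. \<lambda>i\<in>e ` T. \<xi> i \<omega>) = PiM (e ` T) (\<lambda>i. distr M S (\<xi> i))"
    using indep_vars_iff_distr_eq_PiM'[of "e ` T" \<xi> "\<lambda>_. S"] ind rv T by simp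
  also have "\<dots> = PiM (e ` T) (\<lambda>_. ?D)" by (rule PiM_cong) (auto simp: eq)
  finally have 1: "distr M (PiM (e ` T) (\<lambda>_. S)) (\<lambda>\<omega>. \<lambda>i\<in>e ` T. \<xi> i \<omega>) = PiM (e ` T) (\<lambda>_. ?D)" .
  have "PiM T (\<lambda>_. ?D) = distr (PiM (e ` T) (\<lambda>_. ?D)) (PiM T (\<lambda>_. ?D)) (\<lambda>x. \<lambda>j\<in>T. x (e j))"
    using distr_PiM_reindex[of "e ` T" "\<lambda>_. ?D" e T] D e by auto
  also have "\<dots> = distr (distr M (PiM (e ` T) (\<lambda>_. S)) (\<lambda>\<omega>. \<lambda>i\<in>e ` T. \<xi> i \<omega>)) (PiM T (\<lambda>_. S)) (\<lambda>x. \<lambda>j\<in>T. x (e j))"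
    unfolding 1 by (intro distr_cong refl sets[symmetric])
  also have "\<dots> = distr M (PiM T (\<lambda>_. S)) ((\<lambda>x. \<lambda>j\<in>T. x (e j)) \<circ> (\<lambda>\<omega>. \<lambda>i\<in>e ` T. \<xi> i \<omega>))"
    by (rule distr_distr) (auto intro!: measurable_restrict measurable_component_singleton rv)
  also have "\<dots> = distr M (PiM T (\<lambda>_. S)) (\<lambda>\<omega>. \<lambda>j\<in>T. \<xi> (e j) \<omega>)"
    by (intro distr_cong refl) (simp add: fun_eq_iff)
  finally show ?thesis ..
qed

text \<open>Exchangeability: both index maps produce the same product law. It serves to move the
  indices of two overlapping subsets to an initial segment.\<close>

lemma (in prob_space) iid_sequence_prob_reindex:
  assumes iid: "iid_sequence M S \<xi>" and e: "inj_on e T" "e ` T \<subseteq> {1..}"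
    and e': "inj_on e' T" "e' ` T \<subseteq> {1..}" and T: "T \<noteq> {}"
    and P: "Measurable.pred (PiM T (\<lambda>_. S)) P"
  shows "\<P>(\<omega> in M. P (\<lambda>j\<in>T. \<xi> (e j) \<omega>)) = \<P>(\<omega> in M. P (\<lambda>j\<in>T. \<xi> (e' j) \<omega>))"
proof -
  have *: "\<P>(\<omega> in M. P (\<lambda>j\<in>T. \<xi> (f j) \<omega>)) =
      measure (PiM T (\<lambda>_. distr M S (\<xi> 1))) {x \<in> space (PiM T (\<lambda>_. S)). P x}"
    if f: "inj_on f T" "f ` T \<subseteq> {1..}" for f
  proof -
    have rv: "(\<lambda>\<omega>. \<lambda>j\<in>T. \<xi> (f j) \<omega>) \<in> measurable M (PiM T (\<lambda>_. S))"
      using f(2) by (intro measurable_restrict iid_sequence_random_variable[OF iid]) auto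
    have "measure (distr M (PiM T (\<lambda>_. S)) (\<lambda>\<omega>. \<lambda>j\<in>T. \<xi> (f j) \<omega>)) {x \<in> space (PiM T (\<lambda>_. S)). P x} =
        prob ((\<lambda>\<omega>. \<lambda>j\<in>T. \<xi> (f j) \<omega>) -` {x \<in> space (PiM T (\<lambda>_. S)). P x} \<inter> space M)"
      using P by (intro measure_distr rv) simp
    also have "\<dots> = \<P>(\<omega> in M. P (\<lambda>j\<in>T. \<xi> (f j) \<omega>))"
      using measurable_space[OF rv] by (intro arg_cong[where f=prob]) blast
    finally show ?thesis unfolding iid_sequence_distr_reindex[OF iid f T] ..
  qed
  show ?thesis using *[OF e] *[OF e'] by simp
qed

section \<open>Symmetric kernels and the combinatorics of finite index sets\<close>

text \<open>Two enumerations of \<open>J\<close> differ by the permutation \<open>b\<close> inverse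
  after \<open>a\<close>, extended by the identity outside \<open>{1..k}\<close>. Hence the kernel
  value depends on the set \<open>J\<close> only.\<close>

lemma symmetric_kernel_subsample:
  assumes sym: "symmetric_kernel k S h" and \<xi>: "\<And>i. i \<in> J \<Longrightarrow> \<xi> i \<omega> \<in> space S"
    and a: "bij_betw a {1..k} J" and b: "bij_betw b {1..k} J"
  shows "h (subsample k \<xi> a \<omega>) = h (subsample k \<xi> b \<omega>)"
proof -
  define \<pi> where "\<pi> j = (if j \<in> {1..k} then inv_into {1..k} b (a j) else j)" for j
  have "bij_betw (inv_into {1..k} b \<circ> a) {1..k} {1..k}"
    using a b by (blast intro: bij_betw_trans bij_betw_inv_into)
  moreover have "bij_betw \<pi> {1..k} {1..k} \<longleftrightarrow> bij_betw (inv_into {1..k} b \<circ> a) {1..k} {1..k}"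
    by (rule bij_betw_cong) (simp add: \<pi>_def)
  ultimately have "bij_betw \<pi> {1..k} {1..k}" by simp
  then have \<pi>: "\<pi> permutes {1..k}"
    by (rule bij_imp_permutes) (auto simp: \<pi>_def)
  have "b (\<pi> j) = a j" if "j \<in> {1..k}" for j
    using that a b by (auto simp: \<pi>_def bij_betw_def intro!: f_inv_into_f)
  moreover have "\<pi> j \<in> {1..k}" if "j \<in> {1..k}" for j using permutes_in_image[OF \<pi>] that by blast
  ultimately have "subsample k \<xi> a \<omega> = (\<lambda>j\<in>{1..k}. subsample k \<xi> b \<omega> (\<pi> j))"
    by (auto simp: subsample_def fun_eq_iff)
  moreover have "subsample k \<xi> b \<omega> \<in> space (PiM {1..k} (\<lambda>_. S))"
    using \<xi> b by (auto simp: subsample_def space_PiM bij_betw_def)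
  ultimately show ?thesis using sym \<pi> unfolding symmetric_kernel_def by simp
qed

text \<open>\<open>J'\<close> corresponds to the pair of its parts inside and outside
  \<open>J\<close>, and these two parts are chosen freely.\<close>

lemma card_subsets_given_overlap:
  assumes U: "finite U" and J: "J \<subseteq> U" and r: "r \<le> k"
  shows "card {J'. J' \<subseteq> U \<and> card J' = k \<and> card (J \<inter> J') = r} =
    (card J choose r) * (card (U - J) choose (k - r))"
proof -
  let ?P = "{P. P \<subseteq> J \<and> card P = r}" and ?Q = "{Q. Q \<subseteq> U - J \<and> card Q = k - r}"
  have finJ: "finite J" using U J finite_subset by blast
  have "bij_betw (\<lambda>(P, Q). P \<union> Q) (?P \<times> ?Q) {J'. J' \<subseteq> U \<and> card J' = k \<and> card (J \<inter> J') = r}"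
  proof (rule bij_betw_byWitness[where f' = "\<lambda>J'. (J \<inter> J', J' - J)"])
    show "(\<lambda>(P, Q). P \<union> Q) ` (?P \<times> ?Q) \<subseteq> {J'. J' \<subseteq> U \<and> card J' = k \<and> card (J \<inter> J') = r}"
    proof clarsimp
      fix P Q assume *: "P \<subseteq> J" "Q \<subseteq> U - J" "r = card P" "card Q = k - card P"
      then have "J \<inter> (P \<union> Q) = P" "P \<inter> Q = {}" "finite P" "finite Q"
        using finJ U by (auto intro: finite_subset)
      then show "P \<subseteq> U \<and> Q \<subseteq> U \<and> card (P \<union> Q) = k \<and> card (J \<inter> (P \<union> Q)) = card P"
        using * r J by (auto simp: card_Un_disjoint)
    qed
    show "(\<lambda>J'. (J \<inter> J', J' - J)) ` {J'. J' \<subseteq> U \<and> card J' = k \<and> card (J \<inter> J') = r} \<subseteq> ?P \<times> ?Q"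
      using finJ by (auto simp: card_Diff_subset_Int Int_commute)
  qed auto
  then have "card {J'. J' \<subseteq> U \<and> card J' = k \<and> card (J \<inter> J') = r} = card ?P * card ?Q"
    by (simp flip: bij_betw_same_card card_cartesian_product)
  then show ?thesis using finJ U by (simp add: n_subsets)
qed

text \<open>The positions list \<open>J - J'\<close>, then \<open>J \<inter> J'\<close>, then
  \<open>J' - J\<close>. Thus \<open>J\<close> fills the first \<open>k\<close> places and
  \<open>J'\<close> the last \<open>k\<close>, which is the shift by \<open>k - r\<close> in
  \<open>exceed_tau\<close>. The case \<open>J = J'\<close>, with shift 0, is included.\<close>

lemma joint_enumeration:
  assumes fin: "finite J" "finite J'" and card: "card J = k" "card J' = k" and r: "card (J \<inter> J') = r"
  obtains e :: "nat \<Rightarrow> 'i" where "bij_betw e {1..2 * k - r} (J \<union> J')" "bij_betw e {1..k} J"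
    "bij_betw (\<lambda>j. e (j + (k - r))) {1..k} J'"
proof -
  have le: "r \<le> k" using fin card r by (metis card_mono inf_le1)
  have cards: "card (J - J') = k - r" "card (J' - J) = k - r"
    using fin card r by (simp_all add: card_Diff_subset_Int Int_commute)
  obtain a where a: "bij_betw a {1..k - r} (J - J')"
    using finite_same_card_bij[of "{1..k - r}" "J - J'"] fin cards by auto
  obtain b where b: "bij_betw b {k - r<..k} (J \<inter> J')"
    using finite_same_card_bij[of "{k - r<..k}" "J \<inter> J'"] fin r le by auto
  obtain c where c: "bij_betw c {k<..2 * k - r} (J' - J)"
    using finite_same_card_bij[of "{k<..2 * k - r}" "J' - J"] fin cards le by auto
  define e where "e j = (if j \<le> k - r then a j else if j \<le> k then b j else c j)" for j
  have e: "bij_betw e {1..k - r} (J - J')" "bij_betw e {k - r<..k} (J \<inter> J')" "bij_betw e {k<..2 * k - r} (J' - J)"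
    by (rule bij_betw_cong[THEN iffD1, OF _ a] bij_betw_cong[THEN iffD1, OF _ b] bij_betw_cong[THEN iffD1, OF _ c];
        use le in \<open>auto simp: e_def\<close>)+
  have 1: "bij_betw e ({1..k - r} \<union> {k - r<..k}) ((J - J') \<union> (J \<inter> J'))"
    by (rule bij_betw_combine[OF e(1,2)]) auto
  have "bij_betw e ({k - r<..k} \<union> {k<..2 * k - r}) ((J \<inter> J') \<union> (J' - J))"
    by (rule bij_betw_combine[OF e(2,3)]) auto
  moreover have "{k - r<..k} \<union> {k<..2 * k - r} = {1 + (k - r)..k + (k - r)}" using le by auto
  moreover have "bij_betw (\<lambda>j. j + (k - r)) {1..k} {1 + (k - r)..k + (k - r)}"
    unfolding bij_betw_def image_add_atLeastAtMost' by (simp add: inj_on_def)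
  ultimately have 2: "bij_betw (\<lambda>j. e (j + (k - r))) {1..k} ((J \<inter> J') \<union> (J' - J))"
    using bij_betw_trans[of "\<lambda>j. j + (k - r)" "{1..k}" _ e] by (simp add: comp_def)
  have 3: "bij_betw e (({1..k - r} \<union> {k - r<..k}) \<union> {k<..2 * k - r}) (((J - J') \<union> (J \<inter> J')) \<union> (J' - J))"
    by (rule bij_betw_combine[OF 1 e(3)]) auto
  have "{1..k - r} \<union> {k - r<..k} = {1..k}" "{1..k} \<union> {k<..2 * k - r} = {1..2 * k - r}"
    "(J - J') \<union> (J \<inter> J') = J" "J \<union> (J' - J) = J \<union> J'" "(J \<inter> J') \<union> (J' - J) = J'"
    using le by auto
  with that[of e] 1 2 3 show ?thesis by simp
qed

text \<open>The increasing enumeration of \<open>J\<close>, moved from indices starting at 0 to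
  indices starting at 1, links subsets to the tuples in the maximum.\<close>

lemma index_tuple_enumerating:
  assumes "J \<subseteq> {1..n}" "card J = k"
  obtains i where "i \<in> index_tuples k n" "bij_betw i {1..k} J"
proof -
  have "finite J" using assms(1) finite_subset by blast
  then obtain g where g: "bij_betw g {..<k} J" "strict_mono_on {..<k} g"
    using assms(2) ex_bij_betw_strict_mono_card by metis
  define i where "i = (\<lambda>j\<in>{1..k}. g (j - 1))"
  have "bij_betw (\<lambda>j. j - 1) {1..k} {..<k}"
    by (rule bij_betw_byWitness[where f' = Suc]) auto
  then have "bij_betw (g \<circ> (\<lambda>j. j - 1)) {1..k} J" by (rule bij_betw_trans) (rule g(1))
  then have bij: "bij_betw i {1..k} J"
    by (rule bij_betw_cong[THEN iffD1, rotated]) (simp add: i_def)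
  have "strict_mono_on {1..k} i"
    by (intro strict_mono_onI) (auto simp: i_def intro!: strict_mono_onD[OF g(2)])
  moreover have "i \<in> {1..k} \<rightarrow>\<^sub>E {1..n}"
    using bij assms(1) by (auto simp: i_def bij_betw_def)
  ultimately show ?thesis using that bij by (simp add: index_tuples_def)
qed

section \<open>The Poisson bound, with events indexed by \<open>k\<close>-subsets\<close>

theorem theorem2p1:
  fixes M :: "'a measure" and S :: "'b measure"
    and \<xi> :: "nat \<Rightarrow> 'a \<Rightarrow> 'b" and h :: "(nat \<Rightarrow> 'b) \<Rightarrow> real"
    and k n :: nat and z :: real
  assumes "prob_space M"
    and "k \<ge> 1"
    and "iid_sequence M S \<xi>"
    and "h \<in> borel_measurable (PiM {1..k} (\<lambda>_. S))"
    and "symmetric_kernel k S h"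
    and "n \<ge> k"
  shows "\<bar>\<P>(\<omega> in M. U_max k h \<xi> n \<omega> \<le> z) - exp (- exceed_rate M k h \<xi> n z)\<bar>
    \<le> (1 - exp (- exceed_rate M k h \<xi> n z)) *
       (exceed_prob M k h \<xi> z * (real (n choose k) - real ((n - k) choose k)) +
        (\<Sum>r=1..k - 1. real (k choose r) * real ((n - k) choose (k - r)) *
                        exceed_tau M k h \<xi> z r))"
proof -
  interpret prob_space M by fact
  note k = \<open>k \<ge> 1\<close> and iid = \<open>iid_sequence M S \<xi>\<close> and h = \<open>h \<in> borel_measurable (PiM {1..k} (\<lambda>_. S))\<close>
    and sym = \<open>symmetric_kernel k S h\<close>
  note rv = iid_sequence_random_variable[OF iid]
  have h_comp: "(\<lambda>x. h (\<lambda>j\<in>{1..k}. x (c j))) \<in> borel_measurable (PiM T (\<lambda>_. S))"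
    if "c ` {1..k} \<subseteq> T" for c :: "nat \<Rightarrow> nat" and T
    using that by (intro measurable_compose[OF _ h] measurable_restrict measurable_component_singleton) auto
  define p where "p = exceed_prob M k h \<xi> z"
  \<comment> \<open>The joint probability before division by \<open>p\<close>. At
    \<open>r = k\<close> the shift is 0 and \<open>q k\<close> is \<open>p\<close> itself.\<close>
  define q where "q r = \<P>(\<omega> in M. h (subsample k \<xi> (\<lambda>j. j) \<omega>) > z \<and>
      h (subsample k \<xi> (\<lambda>j. j + (k - r)) \<omega>) > z)" for r
  define K where "K = {J. J \<subseteq> {1..n} \<and> card J = k}"
  have "\<exists>i. i \<in> index_tuples k n \<and> bij_betw i {1..k} J" if "J \<in> K" for J
    using that index_tuple_enumerating[of J n k] unfolding K_def by blast
  then obtain t where t: "\<And>J. J \<in> K \<Longrightarrow> t J \<in> index_tuples k n" "\<And>J. J \<in> K \<Longrightarrow> bij_betw (t J) {1..k} J"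
    by metis
  have finK: "finite K" unfolding K_def by (rule finite_subset[of _ "Pow {1..n}"]) auto
  have K: "finite J" "J \<subseteq> {1..}" "J \<subseteq> {1..n}" "card J = k" if "J \<in> K" for J
    using that by (auto simp: K_def intro: finite_subset)
  define X where "X J \<omega> = h (subsample k \<xi> (t J) \<omega>)" for J \<omega>
  define E where "E J = {\<omega> \<in> space M. X J \<omega> > z}" for J
  \<comment> \<open>The dependency neighbourhood of \<open>J\<close>; it contains \<open>J\<close>
    itself because \<open>k\<close> is at least 1.\<close>
  define B where "B J = {J' \<in> K. J \<inter> J' \<noteq> {}}" for J
  \<comment> \<open>By symmetry of \<open>h\<close> the chosen \<open>t J\<close> may be exchanged
    for any enumeration of \<open>J\<close>, at points of \<open>space M\<close>, where the
    observations lie in \<open>space S\<close>.\<close>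
  have X_eq: "X J \<omega> = h (subsample k \<xi> i \<omega>)"
    if "J \<in> K" "bij_betw i {1..k} J" "\<omega> \<in> space M" for J i \<omega>
    unfolding X_def using measurable_space[OF rv] that K(2)
    by (intro symmetric_kernel_subsample[OF sym _ t(2)]) auto
  have X: "X J \<in> borel_measurable M" if "J \<in> K" for J
  proof -
    have "t J j \<ge> 1" if "j \<in> {1..k}" for j
      using bij_betwE[OF t(2)[OF \<open>J \<in> K\<close>]] K(2)[OF \<open>J \<in> K\<close>] that by auto
    then show ?thesis unfolding X_def subsample_def
      by (intro measurable_compose[OF _ h] measurable_restrict rv)
  qed
  have E: "E J \<in> events" if "J \<in> K" for J
    using X[OF that] unfolding E_def by measurable
  have U_max: "U_max k h \<xi> n \<omega> \<le> z \<longleftrightarrow> (\<forall>J\<in>K. \<omega> \<notin> E J)" if \<omega>: "\<omega> \<in> space M" for \<omega>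
  proof -
    have fin: "finite (index_tuples k n)"
      unfolding index_tuples_def by (rule finite_subset[of _ "{1..k} \<rightarrow>\<^sub>E {1..n}"]) (auto intro: finite_PiE)
    \<comment> \<open>This makes the set under \<open>Max\<close> nonempty, and it is where
      \<open>n \<ge> k\<close> enters.\<close>
    have "{1..k} \<in> K" using \<open>n \<ge> k\<close> by (auto simp: K_def)
    then have "index_tuples k n \<noteq> {}" using t(1) by blast
    then have "U_max k h \<xi> n \<omega> \<le> z \<longleftrightarrow> (\<forall>i\<in>index_tuples k n. h (subsample k \<xi> i \<omega>) \<le> z)"
      unfolding U_max_def using fin by (subst Max_le_iff) auto
    also have "\<dots> \<longleftrightarrow> (\<forall>J\<in>K. X J \<omega> \<le> z)"
    proof safe
      fix J assume "\<forall>i\<in>index_tuples k n. h (subsample k \<xi> i \<omega>) \<le> z" "J \<in> K"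
      then show "X J \<omega> \<le> z" using t(1) by (simp add: X_def)
    next
      fix i assume le: "\<forall>J\<in>K. X J \<omega> \<le> z" and i: "i \<in> index_tuples k n"
      have bij: "bij_betw i {1..k} (i ` {1..k})"
        using i strict_mono_on_imp_inj_on by (auto simp: index_tuples_def bij_betw_def)
      moreover have "i ` {1..k} \<in> K"
        using i bij_betw_same_card[OF bij] by (auto simp: K_def index_tuples_def)
      ultimately show "h (subsample k \<xi> i \<omega>) \<le> z" using le X_eq \<omega> by metis
    qed
    finally show ?thesis using \<omega> by (auto simp: E_def not_less)
  qed
  have indep: "indep_var borel (indicat_real (E J)) borel (\<lambda>\<omega>. real (card {J' \<in> K - B J. \<omega> \<in> E J'}))"
    if J: "J \<in> K" for J
  proof -
    \<comment> \<open>The exceedance of \<open>J\<close> as a function of an observation vector over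
      any index set containing \<open>J\<close>. The indicator of \<open>E J\<close> then depends on
      the block \<open>J\<close> and the count of far events on the complementary block, and the two
      blocks are independent.\<close>
    define ind where "ind J x = (if h (\<lambda>j\<in>{1..k}. x (t J j)) > z then 1 else 0 :: real)" for J x
    have ind: "ind J' \<in> borel_measurable (PiM T (\<lambda>_. S))" if "J' \<in> K" "J' \<subseteq> T" for J' T
    proof -
      have [measurable]: "(\<lambda>x. h (\<lambda>j\<in>{1..k}. x (t J' j))) \<in> borel_measurable (PiM T (\<lambda>_. S))"
        using t(2)[OF that(1)] that(2) by (intro h_comp) (simp add: bij_betw_def)
      show ?thesis unfolding ind_def by measurable
    qed
    have ind_eq: "ind J' (\<lambda>i\<in>T. \<xi> i \<omega>) = indicator (E J') \<omega>"
      if "J' \<in> K" "J' \<subseteq> T" "\<omega> \<in> space M" for J' T \<omega>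
    proof -
      have "(\<lambda>j\<in>{1..k}. (\<lambda>i\<in>T. \<xi> i \<omega>) (t J' j)) = subsample k \<xi> (t J') \<omega>"
        using bij_betwE[OF t(2)[OF that(1)]] that(2) by (auto simp: subsample_def fun_eq_iff)
      then show ?thesis using that(3) by (simp add: ind_def E_def X_def)
    qed
    have far: "J' \<in> K" "J' \<subseteq> {1..n} - J" if "J' \<in> K - B J" for J'
      using that K(3) by (auto simp: B_def)
    have "indep_vars (\<lambda>_. S) \<xi> {1..}" using iid by (simp add: iid_sequence_def)
    then have "indep_var (PiM J (\<lambda>_. S)) (\<lambda>\<omega>. \<lambda>i\<in>J. \<xi> i \<omega>)
        (PiM ({1..n} - J) (\<lambda>_. S)) (\<lambda>\<omega>. \<lambda>i\<in>{1..n} - J. \<xi> i \<omega>)"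
      by (rule indep_var_restrict) (use K(2)[OF J] in auto)
    then have "indep_var borel (ind J \<circ> (\<lambda>\<omega>. \<lambda>i\<in>J. \<xi> i \<omega>))
        borel ((\<lambda>x. \<Sum>J'\<in>K - B J. ind J' x) \<circ> (\<lambda>\<omega>. \<lambda>i\<in>{1..n} - J. \<xi> i \<omega>))"
    proof (rule indep_var_compose)
      show "ind J \<in> borel_measurable (PiM J (\<lambda>_. S))" by (rule ind[OF J order_refl])
      show "(\<lambda>x. \<Sum>J'\<in>K - B J. ind J' x) \<in> borel_measurable (PiM ({1..n} - J) (\<lambda>_. S))"
        by (rule borel_measurable_sum) (rule ind[OF far])
    qed
    then show ?thesis
    \<comment> \<open>\<open>E J\<close> is cut down to \<open>space M\<close>, so the two
      descriptions agree only there.\<close>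
    proof (rule indep_var_cong_space)
      fix \<omega> assume \<omega>: "\<omega> \<in> space M"
      show "(ind J \<circ> (\<lambda>\<omega>. \<lambda>i\<in>J. \<xi> i \<omega>)) \<omega> = indicat_real (E J) \<omega>"
        using ind_eq[OF J order_refl \<omega>] by simp
      have "((\<lambda>x. \<Sum>J'\<in>K - B J. ind J' x) \<circ> (\<lambda>\<omega>. \<lambda>i\<in>{1..n} - J. \<xi> i \<omega>)) \<omega>
          = (\<Sum>J'\<in>K - B J. indicator (E J') \<omega>)"
        using ind_eq[OF far \<omega>] by simp
      also have "\<dots> = real (card {J' \<in> K - B J. \<omega> \<in> E J'})"
        using finK by (simp add: indicator_def sum.If_cases Int_def)
      finally show "((\<lambda>x. \<Sum>J'\<in>K - B J. ind J' x) \<circ> (\<lambda>\<omega>. \<lambda>i\<in>{1..n} - J. \<xi> i \<omega>)) \<omega>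
          = real (card {J' \<in> K - B J. \<omega> \<in> E J'})" .
    qed
  qed
  \<comment> \<open>With \<open>J \<union> J'\<close> enumerated jointly by \<open>e\<close>, both
    exceedances become one predicate \<open>P\<close> of \<open>2 * k - r\<close> observations, and
    exchangeability replaces \<open>e\<close> by the identity.\<close>
  have prob_Int: "prob (E J \<inter> E J') = q (card (J \<inter> J'))" if J: "J \<in> K" "J' \<in> K" for J J'
  proof -
    define r where "r = card (J \<inter> J')"
    have le: "r \<le> k" using K[OF J(1)] unfolding r_def by (metis card_mono inf_le1)
    obtain e where e: "bij_betw e {1..2 * k - r} (J \<union> J')" "bij_betw e {1..k} J"
        "bij_betw (\<lambda>j. e (j + (k - r))) {1..k} J'"
      using joint_enumeration[of J J' k r] K(1,4)[OF J(1)] K(1,4)[OF J(2)] r_def by metis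
    define P where "P x \<longleftrightarrow> h (\<lambda>j\<in>{1..k}. x j) > z \<and> h (\<lambda>j\<in>{1..k}. x (j + (k - r))) > z" for x
    have P: "Measurable.pred (PiM {1..2 * k - r} (\<lambda>_. S)) P"
    proof -
      have "(\<lambda>j. j) ` {1..k} \<subseteq> {1..2 * k - r}" "(\<lambda>j. j + (k - r)) ` {1..k} \<subseteq> {1..2 * k - r}"
        using le by auto
      note [measurable] = this[THEN h_comp]
      show ?thesis unfolding P_def by measurable
    qed
    have P_eq: "P (\<lambda>j\<in>{1..2 * k - r}. \<xi> (f j) \<omega>) \<longleftrightarrow>
        h (subsample k \<xi> f \<omega>) > z \<and> h (subsample k \<xi> (\<lambda>j. f (j + (k - r))) \<omega>) > z" for f \<omega>
    proof -
      have "(\<lambda>j\<in>{1..k}. (\<lambda>j\<in>{1..2 * k - r}. \<xi> (f j) \<omega>) j) = subsample k \<xi> f \<omega>"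
        "(\<lambda>j\<in>{1..k}. (\<lambda>j\<in>{1..2 * k - r}. \<xi> (f j) \<omega>) (j + (k - r))) = subsample k \<xi> (\<lambda>j. f (j + (k - r))) \<omega>"
        using le by (auto simp: subsample_def fun_eq_iff)
      then show ?thesis unfolding P_def by (simp only:)
    qed
    have "prob (E J \<inter> E J') = \<P>(\<omega> in M. P (\<lambda>j\<in>{1..2 * k - r}. \<xi> (e j) \<omega>))"
      unfolding P_eq using X_eq[OF J(1) e(2)] X_eq[OF J(2) e(3)]
      by (intro arg_cong[where f=prob]) (auto simp: E_def)
    also have "\<dots> = \<P>(\<omega> in M. P (\<lambda>j\<in>{1..2 * k - r}. \<xi> (id j) \<omega>))"
      using e(1) K(2)[OF J(1)] K(2)[OF J(2)] k le
      by (intro iid_sequence_prob_reindex[OF iid _ _ _ _ _ P]) (auto simp: bij_betw_def)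
    also have "\<dots> = q r" unfolding P_eq q_def by (simp add: id_def)
    finally show ?thesis by (simp add: r_def)
  qed
  \<comment> \<open>This is the case \<open>J' = J\<close> of \<open>prob_Int\<close>, with overlap
    \<open>k\<close>.\<close>
  have prob_E: "prob (E J) = p" if "J \<in> K" for J
    using prob_Int[OF that that] K(4)[OF that] by (simp add: q_def p_def exceed_prob_def)
  have cardK: "card K = n choose k" unfolding K_def by (simp add: n_subsets)
  have card_B: "real (card (B J)) = real (n choose k) - real ((n - k) choose k)" if J: "J \<in> K" for J
  proof -
    define D where "D = {J'. J' \<subseteq> {1..n} - J \<and> card J' = k}"
    \<comment> \<open>Counting by complement: the subsets outside \<open>B J\<close> are the
      \<open>k\<close>-subsets of the \<open>n - k\<close> remaining indices.\<close>
    have D: "D \<subseteq> K" "B J = K - D" by (auto simp: D_def K_def B_def)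
    have "card D = (n - k) choose k"
      using K[OF J] by (simp add: D_def n_subsets card_Diff_subset)
    moreover have "card (B J) = card K - card D" "card D \<le> card K"
      using D finK by (simp_all add: card_Diff_subset finite_subset card_mono)
    ultimately show ?thesis by (simp add: cardK of_nat_diff)
  qed
  have sum_B: "(\<Sum>J'\<in>B J - {J}. prob (E J \<inter> E J')) =
      (\<Sum>r=1..k - 1. real (k choose r) * real ((n - k) choose (k - r)) * q r)" if J: "J \<in> K" for J
  proof -
    \<comment> \<open>Overlap 0 is excluded by \<open>B J\<close>, and overlap \<open>k\<close>
      would force \<open>J' = J\<close>. The sum can therefore be grouped by \<open>r\<close> from 1
      to \<open>k - 1\<close>.\<close>
    have overlap: "card (J \<inter> J') \<in> {1..k - 1}" if J': "J' \<in> B J - {J}" for J'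
    proof -
      have "J' \<in> K" using J' by (simp add: B_def)
      have "J \<inter> J' \<noteq> J"
        using J' K(1,4)[OF \<open>J' \<in> K\<close>] K(4)[OF J] card_subset_eq[of J' J] by blast
      then have "card (J \<inter> J') < k" using K(1,4)[OF J] psubset_card_mono[of J "J \<inter> J'"] by auto
      moreover have "card (J \<inter> J') > 0" using J' K(1)[OF J] by (auto simp: B_def card_gt_0_iff)
      ultimately show ?thesis by auto
    qed
    have "(\<Sum>J'\<in>B J - {J}. prob (E J \<inter> E J')) = (\<Sum>J'\<in>B J - {J}. q (card (J \<inter> J')))"
      using J by (intro sum.cong refl prob_Int) (auto simp: B_def)
    also have "\<dots> = (\<Sum>r=1..k - 1. \<Sum>J'\<in>{J' \<in> B J - {J}. card (J \<inter> J') = r}. q (card (J \<inter> J')))"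
    proof (rule sum.group[symmetric])
      show "finite (B J - {J})" using finK by (simp add: B_def)
      show "(\<lambda>J'. card (J \<inter> J')) ` (B J - {J}) \<subseteq> {1..k - 1}" using overlap by blast
    qed simp
    also have "\<dots> = (\<Sum>r=1..k - 1. real (k choose r) * real ((n - k) choose (k - r)) * q r)"
    proof (rule sum.cong[OF refl])
      fix r assume r: "r \<in> {1..k - 1}"
      then have "{J' \<in> B J - {J}. card (J \<inter> J') = r} = {J'. J' \<subseteq> {1..n} \<and> card J' = k \<and> card (J \<inter> J') = r}"
        using K(4)[OF J] by (auto simp: B_def K_def)
      moreover have "card {J'. J' \<subseteq> {1..n} \<and> card J' = k \<and> card (J \<inter> J') = r} = (k choose r) * ((n - k) choose (k - r))"
        using card_subsets_given_overlap[of "{1..n}" J r k] K[OF J] r by (auto simp: card_Diff_subset)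
      ultimately show "(\<Sum>J'\<in>{J' \<in> B J - {J}. card (J \<inter> J') = r}. q (card (J \<inter> J'))) =
          real (k choose r) * real ((n - k) choose (k - r)) * q r"
        by simp
    qed
    finally show ?thesis .
  qed
  \<comment> \<open>If \<open>p = 0\<close>, then \<open>exceed_tau\<close> is 0 by definition, and
    \<open>q r\<close> is 0 as well because it lies between 0 and \<open>p\<close>.\<close>
  have q: "q r = p * exceed_tau M k h \<xi> z r" for r
  proof -
    have "{1..k} \<in> K" using \<open>n \<ge> k\<close> by (auto simp: K_def)
    from bij_betw_id[of "{1..k}"] X_eq[OF this, of id]
    have "{\<omega> \<in> space M. h (subsample k \<xi> (\<lambda>j. j) \<omega>) > z} = E {1..k}"
      by (auto simp: E_def id_def)
    then have "q r \<le> p" unfolding q_def p_def exceed_prob_def using E[OF \<open>{1..k} \<in> K\<close>]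
      by (intro finite_measure_mono) auto
    moreover have "q r \<ge> 0" by (simp add: q_def)
    ultimately show ?thesis
      unfolding exceed_tau_def by (auto simp flip: p_def q_def)
  qed
  define l where "l = (\<Sum>J\<in>K. prob (E J))"
  define R where "R = p * (real (n choose k) - real ((n - k) choose k)) +
    (\<Sum>r=1..k - 1. real (k choose r) * real ((n - k) choose (k - r)) * exceed_tau M k h \<xi> z r)"
  have l: "l = real (n choose k) * p" unfolding l_def by (simp add: prob_E cardK)
  \<comment> \<open>The contribution is the same for every \<open>J\<close>, so the total is
    \<open>l * R\<close> and its factor \<open>l\<close> cancels the denominator in the Chen-Stein
    bound.\<close>
  have "(\<Sum>J'\<in>B J. prob (E J) * prob (E J')) + (\<Sum>J'\<in>B J - {J}. prob (E J \<inter> E J')) = p * R" if J: "J \<in> K" for J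
  proof -
    have "(\<Sum>J'\<in>B J. prob (E J) * prob (E J')) = (\<Sum>J'\<in>B J. p * p)"
      by (intro sum.cong refl) (use J prob_E in \<open>auto simp: B_def\<close>)
    then show ?thesis
      by (simp add: sum_B[OF J] card_B[OF J] q R_def distrib_left sum_distrib_left mult_ac)
  qed
  then have "(\<Sum>J\<in>K. (\<Sum>J'\<in>B J. prob (E J) * prob (E J')) + (\<Sum>J'\<in>B J - {J}. prob (E J \<inter> E J'))) = l * R"
    by (simp add: cardK l)
  moreover have "\<bar>prob (space M - \<Union> (E ` K)) - exp (- l)\<bar> \<le> (1 - exp (- l)) / l *
      (\<Sum>J\<in>K. (\<Sum>J'\<in>B J. prob (E J) * prob (E J')) + (\<Sum>J'\<in>B J - {J}. prob (E J \<inter> E J')))"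
  proof (rule chen_stein_void_probability[OF finK E _ _ indep l_def])
    show "J \<in> B J" if "J \<in> K" for J using that K(4)[OF that] k by (auto simp: B_def)
  qed (auto simp: B_def)
  ultimately have "\<bar>prob (space M - \<Union> (E ` K)) - exp (- l)\<bar> \<le> (1 - exp (- l)) * R"
    \<comment> \<open>For \<open>l = 0\<close> nothing can be cancelled, but both upper bounds are
      then 0.\<close>
    by (cases "l = 0") auto
  moreover have "\<P>(\<omega> in M. U_max k h \<xi> n \<omega> \<le> z) = prob (space M - \<Union> (E ` K))"
    using U_max by (intro arg_cong[where f=prob]) blast
  moreover have "exceed_rate M k h \<xi> n z = l" by (simp add: l exceed_rate_def p_def)
  ultimately show ?thesis unfolding R_def p_def by simp
qed

end
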